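(* Let $q$ be a prime power and let $\ell,s,r_0,\ldots,r_{\ell-1}$ be positive integers such that $s=(q-1)/\ell$ and $\gcd(r_i,s)=1$ for all $i=0,\ldots,\ell-1$. Let $A_0,\ldots,A_{\ell-1}\in\mathbb{F}_q^*$. Define $P:\mathbb{F}_q\to\mathbb{F}_q$ by $P(0)=0$ and $P(x)=A_i x^{r_i}$ if $x\in C_i$, for $0\le i\le \ell-1$. Then the following are equivalent. (a) $P(x)$ is a permutation polynomial of $\mathbb{F}_q$. (b) $A_iC_{ir_i}\neq A_{i'}C_{i'r_{i'}}$ for all $0\le i<i'\le \ell-1$, where the subscripts of $C_{ir_i}$ are taken modulo $\ell$. (c) $\mathrm{Ind}_\gamma\left(\frac{A_i}{A_{i'}}\right)\not\equiv r_{i'}i'-r_i i \pmod{\ell}$ for all $0\le i<i'\le \ell-1$. (d) $\{A_0, A_1\gamma^{r_1},\ldots,A_{\ell-1}\gamma^{(\ell-1)r_{\ell-1}}\}$ is a system of distinct representatives of $\mathbb{F}_q^*/C_0$. (e) $\{A_i^s\zeta^{ir_i}\mid i=0,\ldots,\ell-1\}$ is the set $\mu_\ell$ of all distinct $\ell$-th roots of unity. (f) $\sum_{i=0}^{\ell-1}\zeta^{cr_i i}A_i^{cs}=0$ for all $c=1,\ldots,\ell-1$.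
   Context: $\mathbb{F}_q$ is the field with $q$ elements, $\gamma$ a fixed primitive element (generator of $\mathbb{F}_q^*$). $C_0=\{\gamma^{\ell j}: 0\le j\le s-1\}$ is the subgroup of index $\ell$ in $\mathbb{F}_q^*$, and $C_i=\gamma^iC_0$ for $0\le i\le\ell-1$. $\zeta=\gamma^s$ is a primitive $\ell$-th root of unity. $\mathrm{Ind}_\gamma(a)$ is the residue class $b \bmod (q-1)$ such that $a=\gamma^b$. A map (or polynomial) is a permutation polynomial (PP) of $\mathbb{F}_q$ if it induces a bijection of $\mathbb{F}_q$. *)

theory Defs
  imports "HOL-Number_Theory.Cong" "HOL-Library.Cardinality"
begin

definition primitive_element :: "'a::{field,finite} \<Rightarrow> bool" where
  "primitive_element \<gamma> \<longleftrightarrow> range (\<lambda>n::nat. \<gamma> ^ n) = UNIV - {0}"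

definition lcoset :: "'a::{field,finite} \<Rightarrow> 'a set \<Rightarrow> 'a set" where
  "lcoset a S = (\<lambda>x. a * x) ` S"

definition C0 :: "'a::{field,finite} \<Rightarrow> nat \<Rightarrow> nat \<Rightarrow> 'a set" where
  "C0 \<gamma> l s = {\<gamma> ^ (l * j) | j. j < s}"

definition cyc_class :: "'a::{field,finite} \<Rightarrow> nat \<Rightarrow> nat \<Rightarrow> nat \<Rightarrow> 'a set" where
  "cyc_class \<gamma> l s i = lcoset (\<gamma> ^ i) (C0 \<gamma> l s)"

(* The quotient of the multiplicative group of the field by a subgroup H, as a set of cosets. *)
definition unit_cosets :: "'a::{field,finite} set \<Rightarrow> 'a set set" where
  "unit_cosets H = {lcoset a H | a. a \<noteq> 0}"

definition distinct_reps :: "'a set \<Rightarrow> 'a set set \<Rightarrow> bool" where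
  "distinct_reps X Q \<longleftrightarrow> X \<subseteq> \<Union>Q \<and> (\<forall>K\<in>Q. \<exists>!x. x \<in> X \<and> x \<in> K)"

(* The index of a is a residue class modulo q - 1; it is represented here as the set of
   all its (integer) members.  For primitive \<gamma> and a \<noteq> 0 it is nonempty. *)
definition Ind :: "'a::{field,finite} \<Rightarrow> 'a \<Rightarrow> int set" where
  "Ind \<gamma> a = {b. \<gamma> powi b = a}"

definition unity_roots :: "nat \<Rightarrow> 'a::{field,finite} set" where
  "unity_roots l = {x. x ^ l = 1}"

end

theory Submission
  imports Defs
begin

text \<open>Put \<open>a\<^sub>i = A\<^sub>i \<gamma>\<^bsup>i r\<^sub>i\<^esup>\<close> and \<open>u\<^sub>i = a\<^sub>i\<^sup>s = A\<^sub>i\<^sup>s \<zeta>\<^bsup>i r\<^sub>i\<^esup>\<close>, an \<open>l\<close>-th root of unity.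
  Since \<open>C\<^sub>0\<close> is the kernel of \<open>x \<mapsto> x\<^sup>s\<close> on the units, two units lie in the same coset of
  \<open>C\<^sub>0\<close> iff their \<open>s\<close>-th powers agree. As \<open>x \<mapsto> x\<^bsup>r\<^sub>i\<^esup>\<close> permutes \<open>C\<^sub>0\<close>, the map \<open>P\<close> carries
  \<open>C\<^sub>i\<close> bijectively onto \<open>a\<^sub>i C\<^sub>0\<close>, so each of the six conditions says that \<open>u\<^sub>0, \<dots>, u\<^bsub>l-1\<^esub>\<close>
  are distinct. For the power sums, if some root \<open>x\<close> were not among the \<open>u\<^sub>i\<close>, then
  \<open>\<Sum>\<^sub>i \<Sum>\<^sub>c (u\<^sub>i / x)\<^sup>c\<close> would vanish, although its terms with \<open>c = 0\<close> contribute \<open>l \<noteq> 0\<close> and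
  the others cancel.\<close>

section \<open>The multiplicative order of a primitive element\<close>

lemma primitive_element_nonzero:
  assumes "primitive_element \<gamma>"
  shows "\<gamma> \<noteq> 0"
proof -
  have "\<gamma> ^ 1 \<in> range (\<lambda>n::nat. \<gamma> ^ n)" by blast
  then show ?thesis using assms by (auto simp: primitive_element_def)
qed

lemma primitive_element_obtain_power:
  assumes "primitive_element \<gamma>" "x \<noteq> 0"
  obtains n :: nat where "x = \<gamma> ^ n"
  using assms by (auto simp: primitive_element_def set_eq_iff image_iff)

text \<open>The least positive period \<open>d\<close> of the powers of \<open>\<gamma>\<close>
  equals the number of distinct powers. These are all the units, so \<open>d\<close> is
  \<open>CARD('a) - 1\<close>.\<close>

lemma primitive_element_power_eq_1_iff:
  fixes \<gamma> :: "'a::{field,finite}"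
  assumes "primitive_element \<gamma>"
  shows "\<gamma> ^ n = 1 \<longleftrightarrow> CARD('a) - 1 dvd n"
proof -
  have nz: "\<gamma> \<noteq> 0" by (rule primitive_element_nonzero[OF assms])
  \<comment> \<open>Pigeonhole: two powers coincide in a finite field, and cancelling gives a
    positive period.\<close>
  have "\<not> inj (\<lambda>n::nat. \<gamma> ^ n)"
    using finite_imageD[of "\<lambda>n::nat. \<gamma> ^ n" UNIV] by auto
  then obtain m k :: nat where "m < k" "\<gamma> ^ m = \<gamma> ^ k"
    unfolding inj_def by (metis linorder_neqE_nat)
  then have "\<gamma> ^ (k - m) = 1" "k - m > 0"
    using nz by (auto simp: power_diff)
  then have ex: "\<exists>d>0. \<gamma> ^ d = 1" by blast
  define d where "d = (LEAST d. d > 0 \<and> \<gamma> ^ d = 1)"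
  have d: "d > 0" "\<gamma> ^ d = 1"
    using LeastI_ex[OF ex] by (auto simp: d_def)
  have least: "d \<le> e" if "e > 0" "\<gamma> ^ e = 1" for e
    using that by (auto simp: d_def intro: Least_le)
  have mod: "\<gamma> ^ n = \<gamma> ^ (n mod d)" for n
  proof -
    have "\<gamma> ^ n = \<gamma> ^ (d * (n div d) + n mod d)" by simp
    also have "\<dots> = \<gamma> ^ (n mod d)" by (simp only: power_add power_mult d) simp
    finally show ?thesis .
  qed
  have "x = y" if "x < d" "y < d" "\<gamma> ^ x = \<gamma> ^ y" "x \<le> y" for x y
  proof (rule ccontr)
    assume "x \<noteq> y"
    then have "\<gamma> ^ (y - x) = 1" "y - x > 0" using that nz by (auto simp: power_diff)
    then have "d \<le> y - x" by (intro least)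
    then show False using that \<open>x \<noteq> y\<close> by linarith
  qed
  then have "inj_on (\<lambda>n. \<gamma> ^ n) {..<d}"
    unfolding inj_on_def by (metis lessThan_iff nat_le_linear)
  then have "card ((\<lambda>n. \<gamma> ^ n) ` {..<d}) = d" by (simp add: card_image)
  moreover have "(\<lambda>n. \<gamma> ^ n) ` {..<d} = range (\<lambda>n::nat. \<gamma> ^ n)"
    using mod d by (auto intro!: image_eqI[where x = "n mod d" for n])
  ultimately have "d = CARD('a) - 1"
    using assms by (simp add: primitive_element_def card_Diff_singleton)
  \<comment> \<open>The remainder \<open>n mod d\<close> is smaller than \<open>d\<close>, so by
    minimality its power is 1 only when it is 0.\<close>
  moreover have "\<gamma> ^ n = 1 \<longleftrightarrow> d dvd n"
    using mod[of n] least[of "n mod d"] d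
    by (metis dvd_eq_mod_eq_0 mod_less_divisor neq0_conv not_le power_0)
  ultimately show ?thesis by simp
qed

text \<open>Integer exponents serve condition (c), where differences of exponents may be
  negative.\<close>

lemma primitive_element_powi_eq_1_iff:
  fixes \<gamma> :: "'a::{field,finite}"
  assumes "primitive_element \<gamma>"
  shows "\<gamma> powi k = 1 \<longleftrightarrow> int (CARD('a) - 1) dvd k"
proof (cases "k \<ge> 0")
  case True
  then show ?thesis
    using primitive_element_power_eq_1_iff[OF assms, of "nat k"]
    by (simp add: power_int_def int_dvd_int_iff[symmetric] del: int_dvd_int_iff)
next
  case False
  then have "\<gamma> powi k = 1 \<longleftrightarrow> \<gamma> ^ nat (- k) = 1"
    by (simp add: power_int_def power_inverse)
  then show ?thesis
    using False primitive_element_power_eq_1_iff[OF assms, of "nat (- k)"]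
    by (simp add: int_dvd_int_iff[symmetric] del: int_dvd_int_iff)
qed

section \<open>The subgroup \<open>C0\<close> and its cosets as fibres of a power map\<close>

lemma C0_eq_image: "C0 \<gamma> l s = (\<lambda>j. \<gamma> ^ (l * j)) ` {..<s}"
  by (auto simp: C0_def)

text \<open>Applied below with \<open>l\<close> and \<open>s\<close> interchanged, to count the
  \<open>l\<close>-th roots of unity.\<close>

lemma inj_on_primitive_element_powers:
  fixes \<gamma> :: "'a::{field,finite}"
  assumes prim: "primitive_element \<gamma>" and ls: "l * s = CARD('a) - 1" and "l > 0"
  shows "inj_on (\<lambda>j. \<gamma> ^ (l * j)) {..<s}"
proof -
  have nz: "\<gamma> \<noteq> 0" by (rule primitive_element_nonzero[OF prim])
  have "x = y" if "x < s" "y < s" "\<gamma> ^ (l * x) = \<gamma> ^ (l * y)" "x \<le> y" for x y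
  proof -
    have "\<gamma> ^ (l * (y - x)) = 1"
      using that nz by (simp add: diff_mult_distrib2 power_diff)
    then have "l * s dvd l * (y - x)"
      using primitive_element_power_eq_1_iff[OF prim] ls by simp
    then have "s dvd y - x" using \<open>l > 0\<close> by simp
    then show "x = y" using that by (auto dest: dvd_imp_le)
  qed
  then show ?thesis
    unfolding inj_on_def by (metis lessThan_iff nat_le_linear)
qed

text \<open>For \<open>x = \<gamma> ^ n\<close>, the equation \<open>x ^ s = 1\<close> means that
  \<open>l * s\<close> divides \<open>n * s\<close>, hence that \<open>l\<close> divides
  \<open>n\<close>. With \<open>l\<close> and \<open>s\<close> interchanged this also parametrises
  the \<open>l\<close>-th roots of unity.\<close>

lemma C0_eq_unity_roots:
  fixes \<gamma> :: "'a::{field,finite}"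
  assumes prim: "primitive_element \<gamma>" and ls: "l * s = CARD('a) - 1" and "s > 0"
  shows "C0 \<gamma> l s = unity_roots s"
proof
  have one: "\<gamma> ^ (l * s) = 1"
    using primitive_element_power_eq_1_iff[OF prim] ls by simp
  show "C0 \<gamma> l s \<subseteq> unity_roots s"
  proof
    fix x assume "x \<in> C0 \<gamma> l s"
    then obtain j where "x = \<gamma> ^ (l * j)" by (auto simp: C0_def)
    then have "x ^ s = (\<gamma> ^ (l * s)) ^ j" by (simp add: power_mult[symmetric] ac_simps)
    then show "x \<in> unity_roots s" by (simp add: one unity_roots_def)
  qed
  show "unity_roots s \<subseteq> C0 \<gamma> l s"
  proof
    fix x :: 'a assume "x \<in> unity_roots s"
    then have xs: "x ^ s = 1" by (simp add: unity_roots_def)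
    then have "x \<noteq> 0" using \<open>s > 0\<close> by (auto simp: zero_power)
    then obtain n where n: "x = \<gamma> ^ n" by (rule primitive_element_obtain_power[OF prim])
    then have "\<gamma> ^ (n * s) = 1" using xs by (simp add: power_mult)
    then have "l * s dvd n * s" using primitive_element_power_eq_1_iff[OF prim] ls by simp
    then have "l dvd n" using \<open>s > 0\<close> by simp
    then obtain k where k: "n = l * k" by blast
    \<comment> \<open>\<open>C0\<close> only admits exponents \<open>l * j\<close> with
      \<open>j < s\<close>, so \<open>k\<close> is reduced modulo \<open>s\<close>.\<close>
    have "l * k = l * s * (k div s) + l * (k mod s)"
      by (metis mult.assoc distrib_left mult_div_mod_eq)
    then have "x = \<gamma> ^ (l * s * (k div s) + l * (k mod s))" using n k by simp
    also have "\<dots> = \<gamma> ^ (l * (k mod s))"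
      by (simp only: power_add power_mult[of _ "l * s"] one) simp
    finally show "x \<in> C0 \<gamma> l s" using \<open>s > 0\<close> by (auto simp: C0_def)
  qed
qed

lemma lcoset_unity_roots:
  fixes a :: "'a::{field,finite}"
  assumes "a \<noteq> 0"
  shows "lcoset a (unity_roots s) = {x. x ^ s = a ^ s}"
proof
  show "lcoset a (unity_roots s) \<subseteq> {x. x ^ s = a ^ s}"
    by (auto simp: lcoset_def unity_roots_def power_mult_distrib)
  show "{x. x ^ s = a ^ s} \<subseteq> lcoset a (unity_roots s)"
  proof
    fix x assume "x \<in> {x. x ^ s = a ^ s}"
    then have "x / a \<in> unity_roots s" "x = a * (x / a)"
      using assms by (auto simp: unity_roots_def power_divide)
    then show "x \<in> lcoset a (unity_roots s)" unfolding lcoset_def by blast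
  qed
qed

lemma lcoset_lcoset: "lcoset a (lcoset b S) = lcoset (a * b) S"
  by (simp add: lcoset_def image_image mult.assoc)

section \<open>Power sums over roots of unity\<close>

lemma of_nat_CARD_eq_0: "of_nat CARD('a) = (0::'a::{field,finite})"
proof -
  \<comment> \<open>Translation by 1 permutes the field, so it leaves the sum of all elements
    unchanged.\<close>
  have "(\<Sum>x\<in>(UNIV::'a set). x) = (\<Sum>x\<in>UNIV. x + 1)"
    by (rule sum.reindex_bij_witness[of _ "\<lambda>x. x + 1" "\<lambda>x. x - 1"]) auto
  also have "\<dots> = (\<Sum>x\<in>(UNIV::'a set). x) + of_nat CARD('a)"
    by (simp add: sum.distrib)
  finally show ?thesis by simp
qed

text \<open>If \<open>l\<close> were 0 in the field, so would be \<open>CARD('a) - 1\<close>; but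
  \<open>CARD('a)\<close> is 0 there, which would give 1 = 0.\<close>

lemma of_nat_nonzero_if_dvd_CARD_minus_1:
  assumes "l dvd CARD('a) - 1"
  shows "of_nat l \<noteq> (0::'a::{field,finite})"
proof
  assume l: "of_nat l = (0::'a)"
  obtain k where k: "CARD('a) - 1 = l * k" using assms by blast
  have "CARD('a) = Suc (CARD('a) - 1)" by simp
  then have "CARD('a) = Suc (l * k)" by (simp only: k)
  then have "of_nat CARD('a) = (1 :: 'a)" by (simp only: of_nat_Suc of_nat_mult l) simp
  then show False by (simp add: of_nat_CARD_eq_0)
qed

lemma power_sum_root_of_unity_eq_0:
  fixes w :: "'a::field"
  assumes "w \<noteq> 1" "w ^ l = 1"
  shows "(\<Sum>k<l. w ^ k) = 0"
  using assms by (simp add: geometric_sum)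

text \<open>From right to left, the \<open>u i\<close> run through every root exactly once, so their
  \<open>c\<close>-th power sum is a geometric sum of ratio \<open>\<gamma> ^ (s * c)\<close>, which
  differs from 1 for 0 < \<open>c\<close> < \<open>l\<close>.\<close>

lemma power_sums_eq_0_iff_image_unity_roots:
  fixes \<gamma> :: "'a::{field,finite}" and u :: "nat \<Rightarrow> 'a"
  assumes prim: "primitive_element \<gamma>" and ls: "l * s = CARD('a) - 1" and "l > 0" "s > 0"
    and u: "\<And>i. i < l \<Longrightarrow> u i ^ l = 1"
  shows "(\<forall>c\<in>{1..<l}. (\<Sum>i<l. u i ^ c) = 0) \<longleftrightarrow> u ` {..<l} = unity_roots l"
proof -
  have roots: "unity_roots l = (\<lambda>k. \<gamma> ^ (s * k)) ` {..<l}"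
    using C0_eq_unity_roots[OF prim _ \<open>l > 0\<close>, of s] ls by (simp add: C0_eq_image mult.commute)
  have inj: "inj_on (\<lambda>k. \<gamma> ^ (s * k)) {..<l}"
    using inj_on_primitive_element_powers[OF prim _ \<open>s > 0\<close>, of l] ls by (simp add: mult.commute)
  show ?thesis
  proof
    assume sums: "\<forall>c\<in>{1..<l}. (\<Sum>i<l. u i ^ c) = 0"
    show "u ` {..<l} = unity_roots l"
    proof
      show "u ` {..<l} \<subseteq> unity_roots l" using u by (auto simp: unity_roots_def)
      show "unity_roots l \<subseteq> u ` {..<l}"
      proof (rule subsetI, rule ccontr)
        fix x :: 'a assume "x \<in> unity_roots l" and x: "x \<notin> u ` {..<l}"
        then have xl: "x ^ l = 1" by (simp add: unity_roots_def)
        then have "x \<noteq> 0" using \<open>l > 0\<close> by (auto simp: zero_power)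
        have "(\<Sum>c<l. (u i / x) ^ c) = 0" if "i < l" for i
          using that x xl u \<open>x \<noteq> 0\<close>
          by (intro power_sum_root_of_unity_eq_0) (auto simp: power_divide)
        then have "0 = (\<Sum>i<l. \<Sum>c<l. (u i / x) ^ c)" by simp
        also have "\<dots> = (\<Sum>c<l. (\<Sum>i<l. u i ^ c) / x ^ c)"
          by (subst sum.swap) (simp add: power_divide sum_divide_distrib)
        also have "\<dots> = (\<Sum>c<l. if c = 0 then of_nat l else 0)"
          using sums by (intro sum.cong) auto
        also have "\<dots> = of_nat l" using \<open>l > 0\<close> by simp
        finally show False
          using of_nat_nonzero_if_dvd_CARD_minus_1[where 'a = 'a, of l] ls by (metis dvd_triv_left)
      qed
    qed
  next
    assume eq: "u ` {..<l} = unity_roots l"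
    \<comment> \<open>There are as many roots as indices, so a map onto them is injective and the
      sum can be reindexed.\<close>
    have "card (unity_roots l :: 'a set) = l" using roots inj by (simp add: card_image)
    then have inju: "inj_on u {..<l}" using eq by (intro eq_card_imp_inj_on) auto
    show "\<forall>c\<in>{1..<l}. (\<Sum>i<l. u i ^ c) = 0"
    proof
      fix c assume c: "c \<in> {1..<l}"
      have "(\<Sum>i<l. u i ^ c) = (\<Sum>x\<in>unity_roots l. x ^ c)"
        by (simp add: eq[symmetric] sum.reindex[OF inju])
      also have "\<dots> = (\<Sum>k<l. (\<gamma> ^ (s * c)) ^ k)"
        unfolding roots sum.reindex[OF inj] by (simp add: power_mult[symmetric] ac_simps)
      also have "\<dots> = 0"
      proof (rule power_sum_root_of_unity_eq_0)
        have "\<not> s * l dvd s * c" using c \<open>s > 0\<close> by (auto dest: dvd_imp_le)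
        then show "\<gamma> ^ (s * c) \<noteq> 1"
          using primitive_element_power_eq_1_iff[OF prim] ls by (simp add: mult.commute)
        show "(\<gamma> ^ (s * c)) ^ l = 1"
          using primitive_element_power_eq_1_iff[OF prim] ls
          by (simp add: power_mult[symmetric] ac_simps flip: ls)
      qed
      finally show "(\<Sum>i<l. u i ^ c) = 0" .
    qed
  qed
qed

text \<open>By Bezout \<open>r\<close> has an inverse \<open>b\<close> modulo \<open>s\<close>, and
  raising to the power \<open>b\<close> undoes raising to the power \<open>r\<close> on the
  \<open>s\<close>-th roots of unity.\<close>

lemma inj_on_power_unity_roots:
  fixes s :: nat
  assumes "gcd r s = 1" "r > 0" "s > 0"
  shows "inj_on (\<lambda>x::'a::{field,finite}. x ^ r) (unity_roots s)"
proof (rule inj_onI)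
  fix x y :: 'a assume x: "x \<in> unity_roots s" and y: "y \<in> unity_roots s" and eq: "x ^ r = y ^ r"
  obtain b c where bc: "r * b = s * c + 1"
    using bezout_nat[of r s] assms by auto
  have "(z ^ r) ^ b = z" if "z \<in> unity_roots s" for z :: 'a
  proof -
    have "(z ^ r) ^ b = z ^ (s * c + 1)" by (simp only: bc flip: power_mult)
    also have "\<dots> = z" using that by (simp add: power_add power_mult unity_roots_def)
    finally show ?thesis .
  qed
  then show "x = y" using x y eq by metis
qed

theorem theorem2p18:
  fixes \<gamma> \<zeta> :: "'a::{field,finite}"
    and l s :: nat
    and r :: "nat \<Rightarrow> nat"
    and A :: "nat \<Rightarrow> 'a"
    and P :: "'a \<Rightarrow> 'a"
  assumes "primitive_element \<gamma>"
    and "l > 0" and "s > 0"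
    and "l dvd CARD('a) - 1" and "s = (CARD('a) - 1) div l"
    and "\<And>i. i < l \<Longrightarrow> r i > 0"
    and "\<And>i. i < l \<Longrightarrow> gcd (r i) s = 1"
    and "\<And>i. i < l \<Longrightarrow> A i \<noteq> 0"
    and "\<zeta> = \<gamma> ^ s"
    and "P 0 = 0"
    and "\<And>i x. i < l \<Longrightarrow> x \<in> cyc_class \<gamma> l s i \<Longrightarrow> P x = A i * x ^ r i"
  shows
    "(bij P \<longleftrightarrow>
        (\<forall>i'<l. \<forall>i<i'. lcoset (A i) (cyc_class \<gamma> l s ((i * r i) mod l))
                     \<noteq> lcoset (A i') (cyc_class \<gamma> l s ((i' * r i') mod l)))) \<and>
     (bij P \<longleftrightarrow>
        (\<forall>i'<l. \<forall>i<i'. \<forall>b \<in> Ind \<gamma> (A i / A i').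
            \<not> [b = int (r i') * int i' - int (r i) * int i] (mod int l))) \<and>
     (bij P \<longleftrightarrow>
        distinct_reps {A i * \<gamma> ^ (i * r i) | i. i < l} (unit_cosets (C0 \<gamma> l s))) \<and>
     (bij P \<longleftrightarrow>
        {A i ^ s * \<zeta> ^ (i * r i) | i. i < l} = unity_roots l) \<and>
     (bij P \<longleftrightarrow>
        (\<forall>c\<in>{1..<l}. (\<Sum>i<l. \<zeta> ^ (c * r i * i) * A i ^ (c * s)) = 0))"
proof -

  \<comment> \<open>Specialisation of the preliminaries to the given \<open>l\<close> and
    \<open>s\<close>\<close>
  note prim = assms(1) and r_pos = assms(6) and coprime = assms(7) and A_nz = assms(8)
    and \<zeta> = assms(9) and P0 = assms(10) and P = assms(11)
  have ls: "l * s = CARD('a) - 1" using assms(4,5) by simp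
  have nz: "\<gamma> \<noteq> 0" by (rule primitive_element_nonzero[OF prim])
  have one: "\<gamma> ^ (l * s) = 1"
    using primitive_element_power_eq_1_iff[OF prim] ls by simp
  have roots: "unity_roots l = (\<lambda>k. \<gamma> ^ (s * k)) ` {..<l}"
    using C0_eq_unity_roots[OF prim _ \<open>l > 0\<close>, of s] ls by (simp add: C0_eq_image mult.commute)
  have inj\<zeta>: "inj_on (\<lambda>k. \<gamma> ^ (s * k)) {..<l}"
    using inj_on_primitive_element_powers[OF prim _ \<open>s > 0\<close>, of l] ls by (simp add: mult.commute)
  have card_roots: "card (unity_roots l :: 'a set) = l"
    using roots inj\<zeta> by (simp add: card_image)
  have coset: "lcoset x (C0 \<gamma> l s) = {y. y ^ s = x ^ s}" if "x \<noteq> 0" for x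
    using C0_eq_unity_roots[OF prim ls \<open>s > 0\<close>] lcoset_unity_roots[OF that] by simp
  have pow_root: "x ^ s \<in> unity_roots l" if "x \<noteq> 0" for x :: 'a
  proof -
    from primitive_element_obtain_power[OF prim that] obtain n where "x = \<gamma> ^ n" .
    then have "(x ^ s) ^ l = (\<gamma> ^ (l * s)) ^ n" by (simp add: power_mult[symmetric] ac_simps)
    then show ?thesis by (simp add: one unity_roots_def)
  qed

  \<comment> \<open>The roots \<open>u i\<close> attached to the classes\<close>
  define a where "a i = A i * \<gamma> ^ (i * r i)" for i
  define u where "u i = a i ^ s" for i
  have a_nz: "a i \<noteq> 0" if "i < l" for i using A_nz[OF that] nz by (simp add: a_def)
  have u_root: "u i \<in> unity_roots l" if "i < l" for i
    using pow_root a_nz that by (simp add: u_def)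
  have u_eq: "u i = A i ^ s * \<zeta> ^ (i * r i)" for i
    by (simp add: u_def a_def \<zeta> power_mult_distrib power_mult[symmetric] ac_simps)
  \<comment> \<open>Domain and target both have \<open>l\<close> elements.\<close>
  have surj_iff: "u ` {..<l} = unity_roots l \<longleftrightarrow> inj_on u {..<l}"
  proof
    assume "u ` {..<l} = unity_roots l"
    then show "inj_on u {..<l}" using card_roots by (intro eq_card_imp_inj_on) auto
  next
    assume "inj_on u {..<l}"
    then show "u ` {..<l} = unity_roots l"
      using card_roots u_root by (intro card_subset_eq) (auto simp: card_image)
  qed
  have inj_iff: "inj_on u {..<l} \<longleftrightarrow> (\<forall>i'<l. \<forall>i<i'. u i \<noteq> u i')"
  proof
    assume inj: "inj_on u {..<l}"
    have "u i \<noteq> u i'" if "i' < l" "i < i'" for i i'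
      using inj_onD[OF inj, of i i'] that by auto
    then show "\<forall>i'<l. \<forall>i<i'. u i \<noteq> u i'" by blast
  next
    assume neq: "\<forall>i'<l. \<forall>i<i'. u i \<noteq> u i'"
    show "inj_on u {..<l}"
    proof (rule inj_onI)
      fix i j assume "i \<in> {..<l}" "j \<in> {..<l}" "u i = u j"
      then show "i = j" using neq by (metis lessThan_iff linorder_neqE_nat)
    qed
  qed

  \<comment> \<open>The classes and their images under \<open>P\<close>\<close>
  \<comment> \<open>Passing to \<open>s\<close>-th powers makes the reduction of subscripts modulo
    \<open>l\<close> in (b) invisible.\<close>
  have mod_s: "\<gamma> ^ ((n mod l) * s) = \<gamma> ^ (n * s)" for n
  proof -
    have "n * s = (l * s) * (n div l) + (n mod l) * s"
      by (metis mult.assoc mult.commute distrib_right mult_div_mod_eq)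
    then show ?thesis by (simp only: power_add power_mult[of _ "l * s"] one) simp
  qed
  \<comment> \<open>The \<open>i\<close>-th class is the fibre of the \<open>s\<close>-th power map
    over \<open>\<zeta> ^ i\<close>.\<close>
  have class_eq: "cyc_class \<gamma> l s i = {x. x ^ s = \<gamma> ^ (s * i)}" for i
    using coset[of "\<gamma> ^ i"] nz by (simp add: cyc_class_def power_mult[symmetric] mult.commute)
  have obtain_class: "\<exists>i<l. x \<in> cyc_class \<gamma> l s i" if "x \<noteq> 0" for x
    using pow_root[OF that] by (auto simp: class_eq roots)
  have P_pow: "P x ^ s = u i" if "i < l" "x \<in> cyc_class \<gamma> l s i" for i x
  proof -
    have "P x ^ s = A i ^ s * (x ^ s) ^ r i"
      using P[OF that] by (simp add: power_mult_distrib power_mult[symmetric] ac_simps)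
    also have "\<dots> = u i"
      using that by (simp add: class_eq u_eq \<zeta> power_mult[symmetric] ac_simps)
    finally show ?thesis .
  qed
  have P_nz: "P x \<noteq> 0" if "x \<noteq> 0" for x
    using obtain_class[OF that] P A_nz that by auto
  have inj_pow: "inj_on (\<lambda>x::'a. x ^ r i) (unity_roots s)" if "i < l" for i
    using inj_on_power_unity_roots coprime r_pos \<open>s > 0\<close> that by blast

  \<comment> \<open>Condition (a)\<close>
  have bij_iff: "bij P \<longleftrightarrow> inj_on u {..<l}"
  proof
    assume bij: "bij P"
    show "inj_on u {..<l}"
    proof (rule inj_onI)
      fix i j assume "i \<in> {..<l}" "j \<in> {..<l}" and eq: "u i = u j"
      then have i: "i < l" and j: "j < l" by auto
      \<comment> \<open>An injective self-map of a finite set is onto. Thus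
        \<open>a j / a i\<close>, an \<open>s\<close>-th root of unity because
        \<open>u i = u j\<close>, has an \<open>r i\<close>-th root \<open>h\<close> among the
        \<open>s\<close>-th roots of unity.\<close>
      have "(\<lambda>x. x ^ r i) ` unity_roots s \<subseteq> (unity_roots s :: 'a set)"
        by (auto simp: unity_roots_def power_mult[symmetric] mult.commute[of "r i"])
          (simp add: power_mult)
      then have "(\<lambda>x. x ^ r i) ` unity_roots s = (unity_roots s :: 'a set)"
        using endo_inj_surj[OF _ _ inj_pow[OF i]] by simp
      moreover have "a j / a i \<in> unity_roots s"
        using eq a_nz[OF i] a_nz[OF j] by (auto simp: u_def unity_roots_def power_divide)
      ultimately obtain h where h: "h \<in> unity_roots s" "h ^ r i = a j / a i"
        by (metis (no_types, lifting) imageE)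
      \<comment> \<open>The points \<open>\<gamma> ^ i * h\<close> and \<open>\<gamma> ^ j\<close>
        are chosen so that \<open>P\<close> sends both to \<open>a j\<close>; injectivity then
        forces the two classes to meet.\<close>
      have hi: "\<gamma> ^ i * h \<in> cyc_class \<gamma> l s i"
        using h by (simp add: class_eq unity_roots_def power_mult_distrib power_mult[symmetric] mult.commute)
      have jj: "\<gamma> ^ j \<in> cyc_class \<gamma> l s j"
        by (simp add: class_eq power_mult[symmetric] mult.commute)
      have "P (\<gamma> ^ i * h) = a i * h ^ r i"
        using P[OF i hi] by (simp add: a_def power_mult_distrib power_mult[symmetric])
      also have "\<dots> = a j" using h a_nz[OF i] by simp
      also have "\<dots> = P (\<gamma> ^ j)"
        using P[OF j jj] by (simp add: a_def power_mult[symmetric])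
      finally have "\<gamma> ^ i * h = \<gamma> ^ j" using bij by (auto simp: bij_def dest: injD)
      then have "\<gamma> ^ (s * i) = \<gamma> ^ (s * j)" using hi jj by (simp add: class_eq)
      then show "i = j" using inj\<zeta> i j by (auto dest: inj_onD)
    qed
  next
    assume inj: "inj_on u {..<l}"
    have "inj P"
    proof (rule injI)
      fix x y assume eq: "P x = P y"
      show "x = y"
      proof (cases "x = 0 \<or> y = 0")
        case True
        then show ?thesis using eq P0 P_nz by metis
      next
        case False
        then obtain i j where i: "i < l" "x \<in> cyc_class \<gamma> l s i" and j: "j < l" "y \<in> cyc_class \<gamma> l s j"
          using obtain_class by blast
        \<comment> \<open>The \<open>s\<close>-th power of the common value reveals the class, so
          \<open>x\<close> and \<open>y\<close> share one; there \<open>x / y\<close> is an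
          \<open>s\<close>-th root of unity, on which \<open>r i\<close>-th powers are
          injective.\<close>
        have "u i = u j" using P_pow i j eq by metis
        then have "i = j" using inj i j by (auto dest: inj_onD)
        have "x ^ r i = y ^ r i" using P i j eq A_nz \<open>i = j\<close> by auto
        then have "(x / y) ^ r i = 1 ^ r i" using False by (simp add: power_divide)
        moreover have "x / y \<in> unity_roots s"
          using i j \<open>i = j\<close> nz by (auto simp: class_eq unity_roots_def power_divide)
        moreover have "(1::'a) \<in> unity_roots s" by (simp add: unity_roots_def)
        ultimately have "x / y = 1" by (rule inj_onD[OF inj_pow[OF i(1)]])
        then show ?thesis using False by simp
      qed
    qed
    then show "bij P" by (simp add: bij_def finite_UNIV_inj_surj)
  qed

  \<comment> \<open>Condition (b)\<close>
  have b_coset: "lcoset (A i) (cyc_class \<gamma> l s ((i * r i) mod l)) = {y. y ^ s = u i}"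
    if "i < l" for i
  proof -
    have "lcoset (A i) (cyc_class \<gamma> l s ((i * r i) mod l)) =
        {y. y ^ s = (A i * \<gamma> ^ ((i * r i) mod l)) ^ s}"
      unfolding cyc_class_def lcoset_lcoset using A_nz[OF that] nz by (intro coset) simp
    also have "(A i * \<gamma> ^ ((i * r i) mod l)) ^ s = u i"
      using mod_s[of "i * r i"] by (simp add: u_def a_def power_mult_distrib power_mult[symmetric])
    finally show ?thesis .
  qed
  \<comment> \<open>The fibre over \<open>u i\<close> contains \<open>a i\<close>, hence is
    nonempty, so equal fibres lie over equal values.\<close>
  have "lcoset (A i) (cyc_class \<gamma> l s ((i * r i) mod l)) =
      lcoset (A j) (cyc_class \<gamma> l s ((j * r j) mod l)) \<longleftrightarrow> u i = u j"
    if "i < l" "j < l" for i j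
    using b_coset that by (auto simp: u_def set_eq_iff)
  then have b: "bij P \<longleftrightarrow>
        (\<forall>i'<l. \<forall>i<i'. lcoset (A i) (cyc_class \<gamma> l s ((i * r i) mod l))
                     \<noteq> lcoset (A i') (cyc_class \<gamma> l s ((i' * r i') mod l)))"
    unfolding bij_iff inj_iff by (meson order.strict_trans)

  \<comment> \<open>Condition (c)\<close>
  have c_cong: "[b = int (r j) * int j - int (r i) * int i] (mod int l) \<longleftrightarrow> u i = u j"
    if "i < l" "j < l" and b: "b \<in> Ind \<gamma> (A i / A j)" for i j b
  proof -
    \<comment> \<open>\<open>?k\<close> is an exponent of \<open>a i / a j\<close>. The
      \<open>s\<close>-th power of this quotient is 1 iff \<open>l * s\<close> divides
      \<open>?k * s\<close>, and cancelling \<open>s\<close> leaves the congruence.\<close>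
    let ?k = "b + int (i * r i) - int (j * r j)"
    have "a i / a j = \<gamma> powi ?k"
      using b nz by (simp add: a_def Ind_def power_int_add power_int_diff flip: power_int_of_nat)
    then have "u i = u j \<longleftrightarrow> (\<gamma> powi ?k) ^ s = 1"
      using a_nz[OF that(1)] a_nz[OF that(2)] by (metis u_def divide_eq_1_iff power_divide power_not_zero)
    also have "\<dots> \<longleftrightarrow> \<gamma> powi (?k * int s) = 1"
      by (simp add: power_int_mult)
    also have "\<dots> \<longleftrightarrow> int l * int s dvd ?k * int s"
      by (simp only: primitive_element_powi_eq_1_iff[OF prim] ls[symmetric] of_nat_mult)
    also have "\<dots> \<longleftrightarrow> int l dvd ?k" using \<open>s > 0\<close> by simp
    also have "\<dots> \<longleftrightarrow> [b = int (r j) * int j - int (r i) * int i] (mod int l)"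
      by (simp add: cong_iff_dvd_diff algebra_simps)
    finally show ?thesis by simp
  qed
  \<comment> \<open>Condition (c) quantifies over all members of the residue class and would hold
    vacuously were it empty.\<close>
  have Ind_ne: "\<exists>b. b \<in> Ind \<gamma> (A i / A j)" if ij: "i < l" "j < l" for i j
  proof -
    have "A i / A j \<noteq> 0" using A_nz ij by simp
    then obtain n where "A i / A j = \<gamma> ^ n" using primitive_element_obtain_power[OF prim] by blast
    then have "int n \<in> Ind \<gamma> (A i / A j)" by (simp add: Ind_def)
    then show ?thesis by blast
  qed
  have "(\<forall>b \<in> Ind \<gamma> (A i / A j). \<not> [b = int (r j) * int j - int (r i) * int i] (mod int l))
      \<longleftrightarrow> u i \<noteq> u j" if "i < l" "j < l" for i j
    using c_cong[OF that] Ind_ne[OF that] by blast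
  then have c: "bij P \<longleftrightarrow>
        (\<forall>i'<l. \<forall>i<i'. \<forall>b \<in> Ind \<gamma> (A i / A i').
            \<not> [b = int (r i') * int i' - int (r i) * int i] (mod int l))"
    unfolding bij_iff inj_iff by (meson order.strict_trans)

  \<comment> \<open>Condition (d)\<close>
  have cosets: "unit_cosets (C0 \<gamma> l s) = (\<lambda>v. {y. y ^ s = v}) ` unity_roots l"
  proof
    show "unit_cosets (C0 \<gamma> l s) \<subseteq> (\<lambda>v. {y. y ^ s = v}) ` unity_roots l"
      using coset pow_root by (auto simp: unit_cosets_def)
    show "(\<lambda>v. {y. y ^ s = v}) ` unity_roots l \<subseteq> unit_cosets (C0 \<gamma> l s)"
    proof clarify
      fix v :: 'a assume "v \<in> unity_roots l"
      then obtain k where "v = \<gamma> ^ (s * k)" by (auto simp: roots)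
      then have "{y. y ^ s = v} = lcoset (\<gamma> ^ k) (C0 \<gamma> l s)"
        using coset[of "\<gamma> ^ k"] nz by (simp add: power_mult[symmetric] mult.commute)
      then show "{y. y ^ s = v} \<in> unit_cosets (C0 \<gamma> l s)"
        using nz by (auto simp: unit_cosets_def)
    qed
  qed
  have d: "bij P \<longleftrightarrow>
        distinct_reps {A i * \<gamma> ^ (i * r i) | i. i < l} (unit_cosets (C0 \<gamma> l s))"
  proof -
    have X: "{A i * \<gamma> ^ (i * r i) | i. i < l} = a ` {..<l}" by (auto simp: a_def)
    have "a ` {..<l} \<subseteq> \<Union> (unit_cosets (C0 \<gamma> l s))"
      using u_root by (auto simp: cosets u_def)
    then have "distinct_reps (a ` {..<l}) (unit_cosets (C0 \<gamma> l s)) \<longleftrightarrow>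
        (\<forall>v\<in>unity_roots l. \<exists>!x. x \<in> a ` {..<l} \<and> x ^ s = v)"
      by (simp add: distinct_reps_def cosets)
    also have "\<dots> \<longleftrightarrow> inj_on u {..<l}"
    proof
      \<comment> \<open>Uniqueness concerns elements, not indices: equal \<open>a i\<close> collapse
        in the set. Existence alone makes \<open>u\<close> surjective, and counting then gives
        injectivity.\<close>
      assume ex1: "\<forall>v\<in>unity_roots l. \<exists>!x. x \<in> a ` {..<l} \<and> x ^ s = v"
      have "unity_roots l \<subseteq> u ` {..<l}"
      proof
        fix v :: 'a assume "v \<in> unity_roots l"
        then obtain x where "x \<in> a ` {..<l}" "x ^ s = v" using ex1 by blast
        then show "v \<in> u ` {..<l}" by (auto simp: u_def)
      qed
      then show "inj_on u {..<l}" using surj_iff u_root by blast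
    next
      assume inj: "inj_on u {..<l}"
      show "\<forall>v\<in>unity_roots l. \<exists>!x. x \<in> a ` {..<l} \<and> x ^ s = v"
      proof
        fix v :: 'a assume "v \<in> unity_roots l"
        then obtain i where i: "i < l" "v = u i" using inj surj_iff by blast
        show "\<exists>!x. x \<in> a ` {..<l} \<and> x ^ s = v"
          using i inj by (intro ex1I[of _ "a i"]) (auto simp: u_def inj_on_def)
      qed
    qed
    finally show ?thesis unfolding X bij_iff by simp
  qed

  \<comment> \<open>Conditions (e) and (f)\<close>
  have "{A i ^ s * \<zeta> ^ (i * r i) | i. i < l} = u ` {..<l}" by (auto simp: u_eq)
  then have e: "bij P \<longleftrightarrow> {A i ^ s * \<zeta> ^ (i * r i) | i. i < l} = unity_roots l"
    unfolding bij_iff surj_iff[symmetric] by simp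

  have "\<zeta> ^ (c * r i * i) * A i ^ (c * s) = u i ^ c" for c i
    by (simp add: u_eq power_mult_distrib power_mult[symmetric] ac_simps)
  then have f: "bij P \<longleftrightarrow>
        (\<forall>c\<in>{1..<l}. (\<Sum>i<l. \<zeta> ^ (c * r i * i) * A i ^ (c * s)) = 0)"
    unfolding bij_iff surj_iff[symmetric]
    using power_sums_eq_0_iff_image_unity_roots[OF prim ls \<open>l > 0\<close> \<open>s > 0\<close>, of u] u_root
    by (simp add: unity_roots_def)

  show ?thesis using b c d e f by blast
qed

end
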